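(* There exists a Boolean algebra $\mathfrak B$ which is approximable but does not carry any strictly positive separable finitely additive measure.
   Context: A (finitely additive) measure on a Boolean algebra $\mathfrak B$ is a function $\mu:\mathfrak B\to[0,\infty)$ with $\mu(a\vee b)=\mu(a)+\mu(b)$ whenever $a\wedge b=0$; it is a probability if $\mu(1)=1$ and strictly positive if $\mu(a)>0$ for all $a\neq0$. $\mathfrak B$ is approximable if there is a sequence $\langle\mu_n:n<\omega\rangle$ of finitely additive probability measures on $\mathfrak B$ such that for every $a\in\mathfrak B\setminus\{0\}$ there is $n$ with $\mu_n(a)>1/2$. A strictly positive measure $\mu$ on $\mathfrak B$ is separable if the metric space $(\mathfrak B,d_\mu)$, where $d_\mu(a,b)=\mu(a\,\triangle\,b)$, has a countable dense subset. *)

theory Defs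
  imports "HOL-Analysis.Analysis"
begin

text \<open>A Boolean algebra is represented (via Stone's representation theorem) as a
field of subsets \<open>A\<close> of a set \<open>\<Omega>\<close>, i.e. the library notion \<open>algebra \<Omega> A\<close>.
Its zero is the empty set, its unit is \<open>\<Omega>\<close>, join is union, meet is intersection.\<close>

definition fa_measure :: "'a set set \<Rightarrow> ('a set \<Rightarrow> real) \<Rightarrow> bool" where
  "fa_measure A \<mu> \<longleftrightarrow>
     (\<forall>a\<in>A. 0 \<le> \<mu> a) \<and>
     (\<forall>a\<in>A. \<forall>b\<in>A. a \<inter> b = {} \<longrightarrow> \<mu> (a \<union> b) = \<mu> a + \<mu> b)"

definition fa_probability :: "'a set \<Rightarrow> 'a set set \<Rightarrow> ('a set \<Rightarrow> real) \<Rightarrow> bool" where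
  "fa_probability \<Omega> A \<mu> \<longleftrightarrow> fa_measure A \<mu> \<and> \<mu> \<Omega> = 1"

definition strictly_positive :: "'a set set \<Rightarrow> ('a set \<Rightarrow> real) \<Rightarrow> bool" where
  "strictly_positive A \<mu> \<longleftrightarrow> (\<forall>a\<in>A. a \<noteq> {} \<longrightarrow> 0 < \<mu> a)"

definition approximable :: "'a set \<Rightarrow> 'a set set \<Rightarrow> bool" where
  "approximable \<Omega> A \<longleftrightarrow>
     (\<exists>\<mu>s :: nat \<Rightarrow> 'a set \<Rightarrow> real.
        (\<forall>n. fa_probability \<Omega> A (\<mu>s n)) \<and>
        (\<forall>a\<in>A. a \<noteq> {} \<longrightarrow> (\<exists>n. \<mu>s n a > 1/2)))"

definition separable_measure :: "'a set set \<Rightarrow> ('a set \<Rightarrow> real) \<Rightarrow> bool" where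
  "separable_measure A \<mu> \<longleftrightarrow>
     (\<exists>D. D \<subseteq> A \<and> countable D \<and>
        (\<forall>a\<in>A. \<forall>\<epsilon>>0. \<exists>d\<in>D. \<mu> ((a - d) \<union> (d - a)) < \<epsilon>))"

end

theory Submission
  imports Defs "HOL-Probability.Probability"
begin

text \<open>The points are the functions \<open>x\<close> on \<open>\<nat> \<times> Pow \<nat>\<close> with two values. Besides the clopen sets,
the algebra contains, for each sequence \<open>u\<close> of finite sets with \<open>card (u n) = n + 2\<close>, the closed set
\<open>d\<close> of those \<open>x\<close> that are constant on no \<open>{n} \<times> u n\<close>.

If \<open>\<mu>\<close> is separable, then on each level \<open>n\<close> uncountably many of the sets \<open>{x. x (n, w)}\<close>
are arbitrarily close to a single set; choosing \<open>u n\<close> among these \<open>w\<close> yields a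
nonempty \<open>d\<close> with \<open>\<mu> d = 0\<close>.

For approximability, take product measures that are deterministic on the levels below \<open>m\<close> and
fair coins above. Sequences of length \<open>n + 2\<close> of coins are constant with summable probabilities, so
these measures are close to 1 on \<open>d\<close> once the levels below \<open>m\<close> are right; and since
the Cantor cube of weight continuum is separable, countably many deterministic parts suffice.\<close>

section \<open>Finitely additive measures\<close>

lemma fa_measure_mono:
  assumes "algebra \<Omega> A" "fa_measure A \<mu>" "a \<in> A" "b \<in> A" "a \<subseteq> b"
  shows "\<mu> a \<le> \<mu> b"
proof -
  interpret algebra \<Omega> A by fact
  have d: "b - a \<in> A" using assms by auto
  have "\<mu> (a \<union> (b - a)) = \<mu> a + \<mu> (b - a)" "0 \<le> \<mu> (b - a)"
    using assms d unfolding fa_measure_def by blast+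
  moreover have "a \<union> (b - a) = b" using assms by auto
  ultimately show ?thesis by simp
qed

lemma fa_measure_Un_le:
  assumes "algebra \<Omega> A" "fa_measure A \<mu>" "a \<in> A" "b \<in> A"
  shows "\<mu> (a \<union> b) \<le> \<mu> a + \<mu> b"
proof -
  interpret algebra \<Omega> A by fact
  have d: "b - a \<in> A" using assms by auto
  have "\<mu> (a \<union> (b - a)) = \<mu> a + \<mu> (b - a)"
    using assms d unfolding fa_measure_def by blast
  moreover have "\<mu> (b - a) \<le> \<mu> b" using fa_measure_mono[OF assms(1,2) d assms(4)] by auto
  ultimately show ?thesis by simp
qed

lemma fa_measure_empty:
  assumes "algebra \<Omega> A" "fa_measure A \<mu>"
  shows "\<mu> {} = 0"
proof -
  interpret algebra \<Omega> A by fact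
  have "\<mu> ({} \<union> {}) = \<mu> {} + \<mu> {}" using assms(2) empty_sets unfolding fa_measure_def by blast
  then show ?thesis by simp
qed

lemma fa_measure_UN_le:
  assumes "algebra \<Omega> A" "fa_measure A \<mu>" "finite S" "\<And>s. s \<in> S \<Longrightarrow> a s \<in> A"
  shows "\<mu> (\<Union>s\<in>S. a s) \<le> (\<Sum>s\<in>S. \<mu> (a s))"
  using assms(3,4)
proof (induction S rule: finite_induct)
  case empty
  then show ?case using fa_measure_empty[OF assms(1,2)] by simp
next
  case (insert s S)
  interpret algebra \<Omega> A by fact
  have "(\<Union>s\<in>S. a s) \<in> A" using insert by (intro finite_UN) auto
  then have "\<mu> (a s \<union> (\<Union>s\<in>S. a s)) \<le> \<mu> (a s) + \<mu> (\<Union>s\<in>S. a s)"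
    using insert.prems by (intro fa_measure_Un_le[OF assms(1,2)]) auto
  also have "\<dots> \<le> \<mu> (a s) + (\<Sum>s\<in>S. \<mu> (a s))" using insert by auto
  finally show ?case using insert by simp
qed

section \<open>The algebra\<close>

type_synonym point = "nat \<times> nat set \<Rightarrow> bool"

text \<open>The size \<open>n + 2\<close> is at least 2, so that a point can take both values on
  every level, and it grows fast enough that the chances of constant coin sequences are
  summable.\<close>

definition size_seq :: "(nat \<Rightarrow> nat set set) \<Rightarrow> bool" where
  "size_seq u \<longleftrightarrow> (\<forall>n. finite (u n) \<and> card (u n) = n + 2)"

definition mixed :: "(nat \<Rightarrow> nat set set) \<Rightarrow> nat \<Rightarrow> point set" where
  "mixed u n = {x. (\<exists>v\<in>u n. x (n, v)) \<and> (\<exists>w\<in>u n. \<not> x (n, w))}"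

definition all_mixed :: "(nat \<Rightarrow> nat set set) \<Rightarrow> point set" where
  "all_mixed u = (\<Inter>n. mixed u n)"

text \<open>Openness in the coarsest topology that refines the product topology and makes every
  \<open>all_mixed u\<close> with \<open>size_seq u\<close> open. A basic neighbourhood fixes the
  finitely many coordinates in \<open>F\<close> and intersects the finitely many sets given by
  \<open>U\<close>.\<close>

definition opn :: "point set \<Rightarrow> bool" where
  "opn a \<longleftrightarrow> (\<forall>x\<in>a. \<exists>F U. finite F \<and> finite U \<and> (\<forall>u\<in>U. size_seq u \<and> x \<in> all_mixed u) \<and>
     (\<forall>y. (\<forall>i\<in>F. y i = x i) \<longrightarrow> (\<forall>u\<in>U. y \<in> all_mixed u) \<longrightarrow> y \<in> a))"

abbreviation cube :: "point measure" where
  "cube \<equiv> PiM UNIV (\<lambda>_. count_space UNIV)"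

text \<open>Clopen sets of this topology, so that each nonempty element contains a basic
  neighbourhood and no normal form for elements is required. Measurability lets the product measures
  below be evaluated on them.\<close>

definition clp :: "point set set" where
  "clp = {a. a \<in> sets cube \<and> opn a \<and> opn (- a)}"

lemma space_cube [simp]: "space cube = UNIV"
  by (simp add: space_PiM)

lemma opnI:
  assumes "\<And>x. x \<in> a \<Longrightarrow> \<exists>F U. finite F \<and> finite U \<and> (\<forall>u\<in>U. size_seq u \<and> x \<in> all_mixed u) \<and>
     (\<forall>y. (\<forall>i\<in>F. y i = x i) \<longrightarrow> (\<forall>u\<in>U. y \<in> all_mixed u) \<longrightarrow> y \<in> a)"
  shows "opn a"
  unfolding opn_def by (rule ballI) (rule assms)

lemma opnE:
  assumes "opn a" "x \<in> a"
  obtains F U where "finite F" "finite U" "\<forall>u\<in>U. size_seq u \<and> x \<in> all_mixed u"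
    "\<forall>y. (\<forall>i\<in>F. y i = x i) \<longrightarrow> (\<forall>u\<in>U. y \<in> all_mixed u) \<longrightarrow> y \<in> a"
proof -
  from bspec[OF assms(1)[unfolded opn_def] assms(2)] obtain F U
    where "finite F \<and> finite U \<and> (\<forall>u\<in>U. size_seq u \<and> x \<in> all_mixed u) \<and>
     (\<forall>y. (\<forall>i\<in>F. y i = x i) \<longrightarrow> (\<forall>u\<in>U. y \<in> all_mixed u) \<longrightarrow> y \<in> a)"
    by (elim exE)
  then show thesis by (elim conjE) (rule that)
qed

lemma opn_if_locally_opn:
  assumes "\<And>x. x \<in> a \<Longrightarrow> \<exists>c. opn c \<and> x \<in> c \<and> c \<subseteq> a"
  shows "opn a"
proof (rule opnI)
  fix x assume "x \<in> a"
  from assms[OF this] obtain c where c: "opn c" "x \<in> c" "c \<subseteq> a" by (elim exE conjE)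
  obtain F U where "finite F" "finite U" "\<forall>u\<in>U. size_seq u \<and> x \<in> all_mixed u"
    "\<forall>y. (\<forall>i\<in>F. y i = x i) \<longrightarrow> (\<forall>u\<in>U. y \<in> all_mixed u) \<longrightarrow> y \<in> c"
    by (rule opnE[OF c(1,2)])
  then show "\<exists>F U. finite F \<and> finite U \<and> (\<forall>u\<in>U. size_seq u \<and> x \<in> all_mixed u) \<and>
     (\<forall>y. (\<forall>i\<in>F. y i = x i) \<longrightarrow> (\<forall>u\<in>U. y \<in> all_mixed u) \<longrightarrow> y \<in> a)"
    using c(3) by (intro exI[of _ F] exI[of _ U]) (simp add: subset_iff)
qed

lemma opn_Un:
  assumes "opn a" "opn b"
  shows "opn (a \<union> b)"
  using assms by (intro opn_if_locally_opn) blast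

lemma opn_Int:
  assumes "opn a" "opn b"
  shows "opn (a \<inter> b)"
proof (rule opnI)
  fix x assume x: "x \<in> a \<inter> b"
  obtain F U where 1: "finite F" "finite U" "\<forall>u\<in>U. size_seq u \<and> x \<in> all_mixed u"
    "\<forall>y. (\<forall>i\<in>F. y i = x i) \<longrightarrow> (\<forall>u\<in>U. y \<in> all_mixed u) \<longrightarrow> y \<in> a"
    by (rule opnE[OF assms(1) IntD1[OF x]])
  obtain F' U' where 2: "finite F'" "finite U'" "\<forall>u\<in>U'. size_seq u \<and> x \<in> all_mixed u"
    "\<forall>y. (\<forall>i\<in>F'. y i = x i) \<longrightarrow> (\<forall>u\<in>U'. y \<in> all_mixed u) \<longrightarrow> y \<in> b"
    by (rule opnE[OF assms(2) IntD2[OF x]])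
  show "\<exists>F U. finite F \<and> finite U \<and> (\<forall>u\<in>U. size_seq u \<and> x \<in> all_mixed u) \<and>
     (\<forall>y. (\<forall>i\<in>F. y i = x i) \<longrightarrow> (\<forall>u\<in>U. y \<in> all_mixed u) \<longrightarrow> y \<in> a \<inter> b)"
    by (rule exI[of _ "F \<union> F'"], rule exI[of _ "U \<union> U'"]) (use 1 2 in \<open>auto simp: ball_Un\<close>)
qed

lemma opn_UNIV: "opn UNIV" and opn_empty: "opn {}"
  unfolding opn_def by auto

lemma algebra_clp: "algebra UNIV clp"
proof -
  have "- a \<in> sets cube" if "a \<in> sets cube" for a
    using sets.compl_sets[OF that] by (simp add: Compl_eq_Diff_UNIV)
  then show ?thesis
    unfolding algebra_iff_Un clp_def
    by (auto simp: opn_Un opn_Int opn_empty opn_UNIV Compl_eq_Diff_UNIV[symmetric])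
qed

lemma coordinate_measurable: "{x. x i = b} \<in> sets cube"
proof -
  have "{x \<in> space cube. x i = b} \<in> sets cube"
    by measurable
  then show ?thesis by simp
qed

lemma opn_determined:
  assumes "finite F" "\<And>x y. x \<in> a \<Longrightarrow> (\<And>i. i \<in> F \<Longrightarrow> y i = x i) \<Longrightarrow> y \<in> a"
  shows "opn a"
proof (rule opnI)
  fix x assume x: "x \<in> a"
  show "\<exists>F U. finite F \<and> finite U \<and> (\<forall>u\<in>U. size_seq u \<and> x \<in> all_mixed u) \<and>
     (\<forall>y. (\<forall>i\<in>F. y i = x i) \<longrightarrow> (\<forall>u\<in>U. y \<in> all_mixed u) \<longrightarrow> y \<in> a)"
    by (rule exI[of _ F], rule exI[of _ "{}"]) (use assms x in auto)
qed

lemma coordinate_clp: "{x. x i} \<in> clp"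
  using coordinate_measurable[of i True]
  by (auto simp: clp_def intro!: opn_determined[of "{i}"])

lemma mixed_measurable:
  assumes "size_seq u"
  shows "mixed u n \<in> sets cube"
proof -
  have fin: "finite (u n)" using assms by (simp add: size_seq_def)
  have "mixed u n = (\<Union>v\<in>u n. {x. x (n, v) = True}) \<inter> (\<Union>v\<in>u n. {x. x (n, v) = False})"
    by (auto simp: mixed_def)
  also have "\<dots> \<in> sets cube"
    using fin by (intro sets.Int sets.finite_UN coordinate_measurable)
  finally show ?thesis .
qed

text \<open>Openness is built into the topology, with \<open>U = {u}\<close>. The complement is open
  already in the product topology: a point outside is constant on some level of \<open>u\<close>,
  which is seen on finitely many coordinates.\<close>

lemma all_mixed_clp:
  assumes "size_seq u"
  shows "all_mixed u \<in> clp"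
proof -
  have "all_mixed u \<in> sets cube"
    unfolding all_mixed_def using mixed_measurable[OF assms] by (intro sets.countable_INT) auto
  moreover have "opn (all_mixed u)"
  proof (rule opnI)
    fix x assume x: "x \<in> all_mixed u"
    show "\<exists>F U. finite F \<and> finite U \<and> (\<forall>u\<in>U. size_seq u \<and> x \<in> all_mixed u) \<and>
     (\<forall>y. (\<forall>i\<in>F. y i = x i) \<longrightarrow> (\<forall>u\<in>U. y \<in> all_mixed u) \<longrightarrow> y \<in> all_mixed u)"
      by (rule exI[of _ "{}"], rule exI[of _ "{u}"]) (use assms x in auto)
  qed
  moreover have "opn (- all_mixed u)"
  proof (rule opnI)
    fix x assume "x \<in> - all_mixed u"
    then obtain n where n: "x \<notin> mixed u n" by (auto simp: all_mixed_def)
    have fin: "finite (Pair n ` u n)" using assms by (simp add: size_seq_def)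
    have "y \<notin> mixed u n" if "\<forall>i\<in>Pair n ` u n. y i = x i" for y
      using n that by (auto simp: mixed_def)
    then have "y \<in> - all_mixed u" if "\<forall>i\<in>Pair n ` u n. y i = x i" for y
      using that by (auto simp: all_mixed_def)
    then show "\<exists>F U. finite F \<and> finite U \<and> (\<forall>u\<in>U. size_seq u \<and> x \<in> all_mixed u) \<and>
       (\<forall>y. (\<forall>i\<in>F. y i = x i) \<longrightarrow> (\<forall>u\<in>U. y \<in> all_mixed u) \<longrightarrow> y \<in> - all_mixed u)"
      by (intro exI[of _ "Pair n ` u n"] exI[of _ "{}"]) (use fin in auto)
  qed
  ultimately show ?thesis by (simp add: clp_def)
qed

lemma all_mixed_nonempty:
  assumes "size_seq u"
  shows "all_mixed u \<noteq> {}"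
proof -
  have "\<exists>v w. v \<in> u n \<and> w \<in> u n \<and> v \<noteq> w" for n
  proof -
    have "2 \<le> card (u n)" using assms by (simp add: size_seq_def)
    then show ?thesis by (metis card_2_iff' ex_card subsetD)
  qed
  then obtain v w where vw: "\<And>n. v n \<in> u n" "\<And>n. w n \<in> u n" "\<And>n. v n \<noteq> w n" by metis
  \<comment> \<open>On level \<open>n\<close> this point is true exactly at \<open>v n\<close>,
    hence false at \<open>w n\<close>.\<close>
  then have "(\<lambda>i. snd i = v (fst i)) \<in> all_mixed u"
    unfolding all_mixed_def mixed_def by (auto intro!: bexI)
  then show ?thesis by auto
qed

section \<open>No strictly positive separable measure\<close>

lemma uncountable_UNIV_nat_set: "uncountable (UNIV :: nat set set)"
proof
  assume "countable (UNIV :: nat set set)"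
  then have "range (from_nat_into (UNIV :: nat set set)) = Pow UNIV"
    by (simp add: range_from_nat_into)
  then show False using Cantors_theorem by blast
qed

text \<open>Otherwise the whole type would be a countable union of finite fibres.\<close>

lemma uncountable_infinite_fiber:
  assumes "uncountable (UNIV :: 'a set)" "countable D" "\<And>w :: 'a. p w \<in> D"
  shows "\<exists>d\<in>D. infinite {w. p w = d}"
proof (rule ccontr)
  assume "\<not> ?thesis"
  then have "countable (\<Union>d\<in>D. {w. p w = d})"
    using assms(2) by (intro countable_UN) (auto intro: countable_finite)
  moreover have "(\<Union>d\<in>D. {w. p w = d}) = UNIV" using assms(3) by auto
  ultimately show False using assms(1) by simp
qed

lemma not_strictly_positive_separable_clp:
  assumes m: "fa_measure clp \<mu>" and pos: "strictly_positive clp \<mu>" and sep: "separable_measure clp \<mu>"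
  shows False
proof -
  interpret algebra UNIV clp by (rule algebra_clp)
  obtain D where D: "D \<subseteq> clp" "countable D"
     "\<And>a \<epsilon>. a \<in> clp \<Longrightarrow> \<epsilon> > 0 \<Longrightarrow> \<exists>d\<in>D. \<mu> ((a - d) \<union> (d - a)) < \<epsilon>"
    using sep unfolding separable_measure_def by blast
  define E where "E n w d = ({x. x (n, w)} - d) \<union> (d - {x :: point. x (n, w)})" for n w d
  \<comment> \<open>Chosen so that \<open>n + 2\<close> sets of measure below
    \<open>\<epsilon> n\<close> have total measure at most \<open>1 / (n + 1)\<close>.\<close>
  define \<epsilon> where "\<epsilon> n = inverse (real (n + 2) * real (n + 1))" for n
  have "\<exists>S d. finite S \<and> card S = n + 2 \<and> d \<in> clp \<and> (\<forall>w\<in>S. \<mu> (E n w d) < \<epsilon> n)" for n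
  proof -
    have "\<epsilon> n > 0" by (simp add: \<epsilon>_def)
    then have "\<forall>w. \<exists>d. d \<in> D \<and> \<mu> (E n w d) < \<epsilon> n"
      unfolding E_def using D(3)[OF coordinate_clp] by (simp add: Bex_def)
    from choice[OF this] obtain p where p: "\<And>w. p w \<in> D" "\<And>w. \<mu> (E n w (p w)) < \<epsilon> n"
      by auto
    \<comment> \<open>Each \<open>w\<close> has an approximant \<open>p w\<close> in the countable
      set \<open>D\<close>, so infinitely many \<open>w\<close> share one approximant
      \<open>d\<close>; any \<open>n + 2\<close> of them can serve as \<open>u n\<close>.\<close>
    from uncountable_infinite_fiber[where p = p, OF uncountable_UNIV_nat_set D(2) p(1)]
    obtain d where d: "d \<in> D" "infinite {w. p w = d}" ..
    from infinite_arbitrarily_large[OF d(2), of "n + 2"]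
    obtain S where S: "finite S" "card S = n + 2" "S \<subseteq> {w. p w = d}" by auto
    then have "\<mu> (E n w d) < \<epsilon> n" if "w \<in> S" for w using p(2)[of w] that by auto
    then show ?thesis using S d(1) D(1) by blast
  qed
  then have "\<forall>n. \<exists>S d. finite S \<and> card S = n + 2 \<and> d \<in> clp \<and> (\<forall>w\<in>S. \<mu> (E n w d) < \<epsilon> n)" ..
  then have "\<exists>u d. \<forall>n. finite (u n) \<and> card (u n) = n + 2 \<and> d n \<in> clp \<and> (\<forall>w\<in>u n. \<mu> (E n w (d n)) < \<epsilon> n)"
    by (simp only: choice_iff)
  then obtain u d where ud: "\<And>n. finite (u n) \<and> card (u n) = n + 2 \<and> d n \<in> clp"
      "\<And>n w. w \<in> u n \<Longrightarrow> \<mu> (E n w (d n)) < \<epsilon> n"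
    by auto
  have size: "size_seq u" using ud by (simp add: size_seq_def)
  have bound: "\<mu> (all_mixed u) \<le> inverse (real (Suc n))" for n
  proof -
    have E: "E n w (d n) \<in> clp" for w
      unfolding E_def using ud(1) coordinate_clp by (intro Un Diff) auto
    \<comment> \<open>A point of \<open>all_mixed u\<close> takes both values on level
      \<open>n\<close>. If it lies in \<open>d n\<close>, a \<open>w\<close> where it is false puts
      it into the symmetric difference; if not, a \<open>w\<close> where it is true does.\<close>
    have "all_mixed u \<subseteq> (\<Union>w\<in>u n. E n w (d n))"
    proof
      fix x assume "x \<in> all_mixed u"
      then have "x \<in> mixed u n" by (simp add: all_mixed_def)
      then show "x \<in> (\<Union>w\<in>u n. E n w (d n))"
        by (cases "x \<in> d n") (auto simp: mixed_def E_def)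
    qed
    moreover have "(\<Union>w\<in>u n. E n w (d n)) \<in> clp" using E ud by (intro finite_UN) auto
    ultimately have "\<mu> (all_mixed u) \<le> \<mu> (\<Union>w\<in>u n. E n w (d n))"
      using all_mixed_clp[OF size] by (intro fa_measure_mono[OF algebra_clp m])
    also have "\<dots> \<le> (\<Sum>w\<in>u n. \<mu> (E n w (d n)))"
      using ud E by (intro fa_measure_UN_le[OF algebra_clp m]) auto
    also have "\<dots> \<le> real (card (u n)) * \<epsilon> n"
      using ud(2) by (intro sum_bounded_above) (auto intro: less_imp_le)
    also have "\<dots> = inverse (real (Suc n))"
      using ud(1)[of n] by (simp add: \<epsilon>_def inverse_mult_distrib flip: of_nat_Suc)
    finally show ?thesis .
  qed
  have "\<mu> (all_mixed u) > 0"
    using pos all_mixed_clp[OF size] all_mixed_nonempty[OF size] by (auto simp: strictly_positive_def)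
  then show False using bound reals_Archimedean by (meson not_le)
qed

section \<open>Approximability\<close>

text \<open>Writing the deterministic factors as point masses \<open>return_pmf (f i)\<close> makes
  every factor a probability measure on the discrete space, so all these products share the
  sigma-algebra of \<open>cube\<close>.\<close>

definition coins :: "nat \<Rightarrow> point \<Rightarrow> point measure" where
  "coins m f = PiM UNIV (\<lambda>i. measure_pmf (if fst i < m then return_pmf (f i) else pmf_of_set UNIV))"

lemma prob_space_coins: "prob_space (coins m f)"
  unfolding coins_def by (intro prob_space_PiM measure_pmf.prob_space_axioms)

lemma sets_coins: "sets (coins m f) = sets cube"
  unfolding coins_def by (intro sets_PiM_cong) auto

lemma space_coins [simp]: "space (coins m f) = UNIV"
  by (simp add: coins_def space_PiM)

text \<open>Cylinders with one common value \<open>b\<close> cover both applications: a single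
  deterministic coordinate, and a whole level of some \<open>u\<close>.\<close>

lemma measure_coins_cylinder:
  assumes "finite J"
  shows "measure (coins m f) {x. \<forall>i\<in>J. x i = b} =
    (\<Prod>i\<in>J. if fst i < m then of_bool (f i = b) else 1 / 2)"
proof -
  let ?p = "\<lambda>i. if fst i < m then return_pmf (f i) else pmf_of_set UNIV"
  interpret product_prob_space "\<lambda>i. measure_pmf (?p i)" UNIV
    by unfold_locales
  have "restrict x J = (\<lambda>i\<in>J. b) \<longleftrightarrow> (\<forall>i\<in>J. x i = b)" for x
    by (simp add: restrict_def fun_eq_iff del: split_paired_All) blast
  then have "{x. \<forall>i\<in>J. x i = b} = prod_emb UNIV (\<lambda>i. measure_pmf (?p i)) J (Pi\<^sub>E J (\<lambda>_. {b}))"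
    by (simp add: prod_emb_def space_PiM vimage_def)
  then have "measure (coins m f) {x. \<forall>i\<in>J. x i = b} = (\<Prod>i\<in>J. measure (measure_pmf (?p i)) {b})"
    unfolding coins_def using assms by (simp only:) (rule measure_PiM_emb, auto)
  also have "\<dots> = (\<Prod>i\<in>J. if fst i < m then of_bool (f i = b) else 1 / 2)"
    by (intro prod.cong refl) (auto simp: measure_pmf_single pmf_return indicator_def)
  finally show ?thesis .
qed

lemma measure_coins_deterministic:
  assumes "fst i < m"
  shows "measure (coins m f) {x. x i \<noteq> f i} = 0"
  using measure_coins_cylinder[of "{i}" m f "\<not> f i"] assms by (simp add: neq_commute)

text \<open>Failing to be mixed means being constantly true or constantly false on
  \<open>n + 2\<close> fair coins; each case has probability
  \<open>(1 / 2) ^ (n + 2)\<close>.\<close>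

lemma measure_coins_mixed:
  assumes "size_seq u" "m \<le> n"
  shows "measure (coins m f) (- mixed u n) \<le> (1 / 2) ^ (n + 1)"
proof -
  interpret prob_space "coins m f" by (rule prob_space_coins)
  let ?J = "Pair n ` u n"
  have J: "finite ?J" "card ?J = n + 2"
    using assms(1) by (auto simp: size_seq_def card_image inj_on_def)
  have val: "measure (coins m f) {x. \<forall>i\<in>?J. x i = b} = (1 / 2) ^ (n + 2)" for b
  proof -
    have "measure (coins m f) {x. \<forall>i\<in>?J. x i = b} = (\<Prod>i\<in>?J. 1 / 2)"
      unfolding measure_coins_cylinder[OF J(1)] using assms(2) by (intro prod.cong) auto
    then show ?thesis using J(2) by simp
  qed
  have ev: "{x. \<forall>i\<in>?J. x i = b} \<in> sets (coins m f)" for b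
  proof -
    have "{x. \<forall>i\<in>?J. x i = b} = UNIV - (\<Union>i\<in>?J. {x. x i = (\<not> b)})" by auto
    also have "\<dots> \<in> sets cube"
      using J(1) coordinate_measurable sets.top[of cube] by (intro sets.Diff sets.finite_UN) auto
    finally show ?thesis by (simp add: sets_coins)
  qed
  have "- mixed u n = {x. \<forall>i\<in>?J. x i = True} \<union> {x. \<forall>i\<in>?J. x i = False}"
    by (auto simp: mixed_def)
  then have "measure (coins m f) (- mixed u n) \<le>
      measure (coins m f) {x. \<forall>i\<in>?J. x i = True} + measure (coins m f) {x. \<forall>i\<in>?J. x i = False}"
    using measure_Un_le[OF ev[of True] ev[of False]] by (simp only:)
  then show ?thesis unfolding val by simp
qed

text \<open>This witnesses the separability of the Cantor cube of weight continuum.\<close>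

definition step_point :: "nat \<times> (nat \<times> bool list) list \<Rightarrow> point" where
  "step_point c i \<longleftrightarrow> (fst i, map (\<lambda>j. j \<in> snd i) [0..<fst c]) \<in> set (snd c)"

lemma finite_nat_sets_separated:
  assumes "finite (W :: nat set set)"
  shows "\<exists>N. \<forall>v\<in>W. \<forall>w\<in>W. (\<forall>j<N. j \<in> v \<longleftrightarrow> j \<in> w) \<longrightarrow> v = w"
proof -
  \<comment> \<open>The first place where \<open>v\<close> and \<open>w\<close> differ. For
    \<open>v = w\<close> the value is unspecified and merely enters the bound
    \<open>N\<close>.\<close>
  define k where "k v w = (LEAST j. (j \<in> v) \<noteq> (j \<in> w))" for v w :: "nat set"
  have k: "(k v w \<in> v) \<noteq> (k v w \<in> w)" if "v \<noteq> w" for v w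
    unfolding k_def by (rule LeastI_ex) (use that in blast)
  have "finite ((\<lambda>(v, w). k v w) ` (W \<times> W))" using assms by simp
  then obtain N where "\<forall>j\<in>(\<lambda>(v, w). k v w) ` (W \<times> W). j < N"
    using finite_nat_set_iff_bounded by blast
  then have "k v w < N" if "v \<in> W" "w \<in> W" for v w using that by auto
  then show ?thesis using k by blast
qed

text \<open>For large \<open>N\<close>, truncating second components to length \<open>N\<close> is
  injective on the finitely many indices in \<open>F\<close>, so it suffices to list the truncations
  of those where \<open>x\<close> is true. The codes \<open>c\<close> form a countable type.\<close>

lemma step_point_dense:
  assumes "finite F"
  shows "\<exists>c. \<forall>i\<in>F. step_point c i = x i"
proof -
  obtain N where N: "\<And>v w. v \<in> snd ` F \<Longrightarrow> w \<in> snd ` F \<Longrightarrow> (\<forall>j<N. j \<in> v \<longleftrightarrow> j \<in> w) \<Longrightarrow> v = w"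
    using finite_nat_sets_separated[OF finite_imageI[OF assms, of snd]] by (elim exE) (rule that, blast)
  let ?code = "\<lambda>i :: nat \<times> nat set. (fst i, map (\<lambda>j. j \<in> snd i) [0..<N])"
  obtain L where L: "set L = ?code ` {i \<in> F. x i}"
    using finite_list[of "?code ` {i \<in> F. x i}"] assms by auto
  have inj: "i = i'" if "i \<in> F" "i' \<in> F" "?code i = ?code i'" for i i'
    using that N[of "snd i" "snd i'"] by (auto simp: prod_eq_iff)
  have "step_point (N, L) i = x i" if i: "i \<in> F" for i
  proof -
    have "step_point (N, L) i \<longleftrightarrow> (\<exists>i'\<in>F. x i' \<and> ?code i = ?code i')"
      unfolding step_point_def by (auto simp: L)
    also have "\<dots> \<longleftrightarrow> x i" using inj i by metis
    finally show ?thesis .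
  qed
  then show ?thesis by blast
qed

text \<open>Inside \<open>a\<close> lies a basic neighbourhood of some \<open>x\<close>.
  Deterministic levels that agree with \<open>x\<close> on finitely many coordinates settle
  \<open>F\<close> and the low levels of each \<open>u\<close> in \<open>U\<close>; only the high
  levels can fail, and a union bound over them stays below \<open>1 / 2\<close>.\<close>

lemma coins_large:
  assumes a: "a \<in> clp" "a \<noteq> {}"
  shows "\<exists>m c. measure (coins m (step_point c)) a > 1 / 2"
proof -
  obtain x where x: "x \<in> a" using a by auto
  have op: "opn a" using a by (simp add: clp_def)
  obtain F U where FU: "finite F" "finite U" "\<forall>u\<in>U. size_seq u \<and> x \<in> all_mixed u"
     "\<forall>y. (\<forall>i\<in>F. y i = x i) \<longrightarrow> (\<forall>u\<in>U. y \<in> all_mixed u) \<longrightarrow> y \<in> a"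
    by (rule opnE[OF op x])
  obtain m0 where m0: "\<And>i. i \<in> F \<Longrightarrow> fst i < m0"
    using finite_nat_set_iff_bounded[of "fst ` F"] FU(1) by auto
  \<comment> \<open>Large enough that \<open>F\<close> lies on levels below \<open>m\<close> and
    that \<open>card U < 2 ^ (m - 1)\<close>, as the final union bound demands.\<close>
  define m where "m = m0 + card U + 2"
  \<comment> \<open>The coordinates on which agreement with \<open>x\<close> is imposed; agreement
    there keeps every \<open>u\<close> in \<open>U\<close> mixed on all levels below
    \<open>m\<close>.\<close>
  define G where "G = F \<union> (\<Union>u\<in>U. \<Union>n<m. Pair n ` u n)"
  have G: "finite G" "\<And>i. i \<in> G \<Longrightarrow> fst i < m"
    using FU m0 by (force simp: G_def size_seq_def m_def)+
  obtain c where c: "\<And>i. i \<in> G \<Longrightarrow> step_point c i = x i" using step_point_dense[OF G(1), of x] by auto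
  let ?f = "step_point c"
  let ?M = "coins m ?f"
  interpret prob_space ?M by (rule prob_space_coins)
  \<comment> \<open>The two ways to miss \<open>a\<close>: \<open>?Z\<close> is disagreement with
    the prescribed point on \<open>G\<close>, a null event, and \<open>?B u\<close> is constancy on
    some level of \<open>u\<close> from \<open>m\<close> on.\<close>
  let ?Z = "\<Union>i\<in>G. {y. y i \<noteq> ?f i}"
  let ?B = "\<lambda>u. \<Union>k. - mixed u (k + m)"
  have a_ev: "a \<in> events" using a by (simp add: clp_def sets_coins)
  have mix_ev: "- mixed u n \<in> events" if "u \<in> U" for u n
  proof -
    have "space ?M - mixed u n \<in> events"
      using mixed_measurable FU(3) that by (intro sets.compl_sets) (simp add: sets_coins)
    then show ?thesis by (simp add: Compl_eq_Diff_UNIV)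
  qed
  have single_ev: "{y. y i \<noteq> ?f i} \<in> events" for i
    using coordinate_measurable[of i "\<not> ?f i"] by (simp add: sets_coins neq_commute)
  have Z_ev: "?Z \<in> events" using G(1) single_ev by (intro sets.finite_UN) auto
  have B_ev: "?B u \<in> events" if "u \<in> U" for u
    using mix_ev[OF that] by (intro sets.countable_UN) auto
  have cover: "- a \<subseteq> ?Z \<union> (\<Union>u\<in>U. ?B u)"
  proof
    fix y assume ya: "y \<in> - a"
    show "y \<in> ?Z \<union> (\<Union>u\<in>U. ?B u)"
    proof (rule ccontr)
      assume neg: "y \<notin> ?Z \<union> (\<Union>u\<in>U. ?B u)"
      then have yG: "y i = x i" if "i \<in> G" for i using c that by auto
      have "y \<in> mixed u n" if u: "u \<in> U" for u n
      proof (cases "n < m")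
        case True
        then have "(n, v) \<in> G" if "v \<in> u n" for v using that u by (auto simp: G_def)
        moreover have "x \<in> mixed u n" using FU(3) u by (simp add: all_mixed_def)
        ultimately show ?thesis using yG unfolding mixed_def by blast
      next
        case False
        then have "n = (n - m) + m" by simp
        moreover have "y \<in> mixed u ((n - m) + m)" using neg u by blast
        ultimately show ?thesis by metis
      qed
      then have "y \<in> a" using yG by (intro FU(4)[rule_format]) (auto simp: G_def all_mixed_def)
      then show False using ya by simp
    qed
  qed
  have "prob ?Z \<le> (\<Sum>i\<in>G. prob {y. y i \<noteq> ?f i})"
    using G(1) single_ev by (intro finite_measure_subadditive_finite) auto
  also have "\<dots> = 0" using G(2) by (intro sum.neutral ballI measure_coins_deterministic)
  finally have Z0: "prob ?Z \<le> 0" .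
  have B_le: "prob (?B u) \<le> (1 / 2) ^ m" if u: "u \<in> U" for u
  proof -
    have le: "prob (- mixed u (k + m)) \<le> (1 / 2) ^ m * (1 / 2) ^ Suc k" for k
      using measure_coins_mixed[of u m "k + m" ?f] FU(3) u by (simp add: power_add mult.commute)
    \<comment> \<open>The bounds \<open>(1 / 2) ^ (k + m + 1)\<close> form a geometric series with
      sum \<open>(1 / 2) ^ m\<close>.\<close>
    have s: "(\<lambda>k. (1 / 2) ^ m * (1 / 2 :: real) ^ Suc k) sums ((1 / 2) ^ m * 1)"
      by (intro sums_mult power_half_series)
    have summ: "summable (\<lambda>k. prob (- mixed u (k + m)))"
      by (rule summable_comparison_test'[OF sums_summable[OF s], of 0]) (use le in simp)
    have "prob (?B u) \<le> (\<Sum>k. prob (- mixed u (k + m)))"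
      using mix_ev[OF u] summ by (intro finite_measure_subadditive_countably) auto
    also have "\<dots> \<le> (\<Sum>k. (1 / 2) ^ m * (1 / 2) ^ Suc k)"
      using le summ sums_summable[OF s] by (intro suminf_le)
    also have "\<dots> = (1 / 2) ^ m" using sums_unique[OF s] by simp
    finally show ?thesis .
  qed
  have "prob (\<Union>u\<in>U. ?B u) \<le> (\<Sum>u\<in>U. prob (?B u))"
    using FU(2) B_ev by (intro finite_measure_subadditive_finite) auto
  also have "\<dots> \<le> real (card U) * (1 / 2) ^ m"
    using B_le by (intro sum_bounded_above)
  also have "\<dots> < 1 / 2"
  proof -
    have "card U < 2 ^ card U" by (rule less_exp)
    also have "\<dots> \<le> 2 ^ (m - 1)" by (intro power_increasing) (auto simp: m_def)
    finally have "real (card U) < 2 ^ (m - 1)" by (metis of_nat_less_iff of_nat_numeral of_nat_power)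
    moreover have "(2 :: real) ^ m = 2 * 2 ^ (m - 1)" by (simp add: m_def)
    ultimately show ?thesis by (simp add: power_one_over field_simps)
  qed
  finally have B: "prob (\<Union>u\<in>U. ?B u) < 1 / 2" .
  have UB_ev: "(\<Union>u\<in>U. ?B u) \<in> events" using sets.finite_UN[OF FU(2) B_ev] .
  have "1 - prob a = prob (- a)" using prob_compl[OF a_ev] by (simp add: Compl_eq_Diff_UNIV)
  also have "\<dots> \<le> prob (?Z \<union> (\<Union>u\<in>U. ?B u))"
    using cover Z_ev UB_ev by (intro finite_measure_mono) auto
  also have "\<dots> \<le> prob ?Z + prob (\<Union>u\<in>U. ?B u)"
    using Z_ev UB_ev by (intro measure_Un_le)
  also have "\<dots> < 1 / 2" using Z0 B by simp
  finally have "prob a > 1 / 2" by simp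
  then show ?thesis by blast
qed

lemma fa_probability_coins: "fa_probability UNIV clp (measure (coins m f))"
proof -
  interpret prob_space "coins m f" by (rule prob_space_coins)
  show ?thesis
    using prob_space
    by (auto simp: fa_probability_def fa_measure_def clp_def sets_coins intro!: finite_measure_Union)
qed

lemma approximable_clp: "approximable UNIV clp"
  unfolding approximable_def
\<comment> \<open>The pairs \<open>(m, c)\<close> form a countable type, so \<open>from_nat\<close>
  lists all the measures in one sequence.\<close>
proof (intro exI[of _ "\<lambda>n. case from_nat n of (m, c) \<Rightarrow> measure (coins m (step_point c))"] conjI allI ballI impI)
  fix n show "fa_probability UNIV clp (case from_nat n of (m, c) \<Rightarrow> measure (coins m (step_point c)))"
    by (auto split: prod.split intro: fa_probability_coins)
next
  fix a assume "a \<in> clp" "a \<noteq> {}"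
  then obtain m c where "measure (coins m (step_point c)) a > 1 / 2" using coins_large by blast
  then show "\<exists>n. (case from_nat n of (m, c) \<Rightarrow> measure (coins m (step_point c))) a > 1 / 2"
    by (intro exI[of _ "to_nat (m, c)"]) simp
qed

section \<open>Transport along injections\<close>

context
  fixes g :: "'a \<Rightarrow> 'b"
  assumes inj: "inj g"
begin

lemma image_algebra:
  assumes "algebra UNIV A"
  shows "algebra (range g) ((`) g ` A)"
proof -
  interpret algebra UNIV A by fact
  have "range g - g ` a = g ` (UNIV - a)" for a using inj by (simp add: image_set_diff)
  then show ?thesis
    unfolding algebra_iff_Un by (auto simp: image_Un[symmetric] intro!: imageI)
qed

lemma image_approximable:
  assumes "approximable UNIV A"
  shows "approximable (range g) ((`) g ` A)"
proof -
  obtain \<mu> :: "nat \<Rightarrow> 'a set \<Rightarrow> real" where \<mu>: "\<forall>n. fa_probability UNIV A (\<mu> n)" "\<forall>a\<in>A. a \<noteq> {} \<longrightarrow> (\<exists>n. \<mu> n a > 1 / 2)"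
    using assms unfolding approximable_def by (elim exE conjE) (rule that)
  have disj: "g ` a \<inter> g ` b = {} \<longleftrightarrow> a \<inter> b = {}" for a b
    using inj by (auto simp: inj_on_def)
  show ?thesis
    unfolding approximable_def
  proof (intro exI[of _ "\<lambda>n b. \<mu> n (g -` b)"] conjI allI)
    fix n show "fa_probability (range g) ((`) g ` A) (\<lambda>b. \<mu> n (g -` b))"
      using spec[OF \<mu>(1), of n]
      by (auto simp: fa_probability_def fa_measure_def inj_vimage_image_eq[OF inj] disj)
  next
    show "\<forall>a\<in>(`) g ` A. a \<noteq> {} \<longrightarrow> (\<exists>n. 1 / 2 < \<mu> n (g -` a))"
      using \<mu>(2) by (auto simp: inj_vimage_image_eq[OF inj])
  qed
qed

lemma preimage_measure:
  assumes "fa_measure ((`) g ` A) \<mu>" "strictly_positive ((`) g ` A) \<mu>" "separable_measure ((`) g ` A) \<mu>"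
  shows "fa_measure A (\<lambda>a. \<mu> (g ` a))" "strictly_positive A (\<lambda>a. \<mu> (g ` a))"
    "separable_measure A (\<lambda>a. \<mu> (g ` a))"
proof -
  have disj: "g ` a \<inter> g ` b = {} \<longleftrightarrow> a \<inter> b = {}" for a b
    using inj by (auto simp: inj_on_def)
  show "fa_measure A (\<lambda>a. \<mu> (g ` a))"
    using assms(1) by (auto simp: fa_measure_def image_Un disj)
  show "strictly_positive A (\<lambda>a. \<mu> (g ` a))"
    using assms(2) by (auto simp: strictly_positive_def)
  obtain D where D: "D \<subseteq> (`) g ` A" "countable D"
     "\<forall>a\<in>(`) g ` A. \<forall>\<epsilon>>0. \<exists>d\<in>D. \<mu> ((a - d) \<union> (d - a)) < \<epsilon>"
    using assms(3) unfolding separable_measure_def by (elim exE conjE)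
  \<comment> \<open>A countable family of images is the image of a countable family, which is then
    dense for the pulled-back measure.\<close>
  obtain D' where D': "D' \<subseteq> A" "countable D'" "D = (`) g ` D'"
    using countable_subset_image[THEN iffD1, OF conjI, OF D(2,1)] by (elim exE conjE)
  have "\<forall>a\<in>A. \<forall>\<epsilon>>0. \<exists>d\<in>D'. \<mu> (g ` ((a - d) \<union> (d - a))) < \<epsilon>"
    using D(3) by (simp add: D'(3) image_Un image_set_diff[OF inj])
  then show "separable_measure A (\<lambda>a. \<mu> (g ` a))"
    unfolding separable_measure_def using D'(1,2) by (intro exI[of _ D'] conjI)
qed

end

text \<open>Brings the algebra from \<open>point\<close> to the type of points in the theorem, by
  coding each index as a set of sets of numbers and each point as the set of codes where it is
  true.\<close>

lemma ex_inj_point: "\<exists>g :: point \<Rightarrow> nat set set set. inj g"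
proof -
  \<comment> \<open>Inserting \<open>0\<close> keeps the product nonempty, so the first component is
    recoverable even from an empty second one; \<open>Suc\<close> keeps that \<open>0\<close> apart
    from genuine elements. The outer singleton only raises the type.\<close>
  define h :: "nat \<times> nat set \<Rightarrow> nat set set" where
    "h p = {prod_encode ` ({fst p} \<times> insert 0 (Suc ` snd p))}" for p
  have "inj h"
  proof (rule injI)
    fix p q assume "h p = h q"
    then have "prod_encode ` ({fst p} \<times> insert 0 (Suc ` snd p)) = prod_encode ` ({fst q} \<times> insert 0 (Suc ` snd q))"
      unfolding h_def by (rule singleton_inject)
    then have "{fst p} \<times> insert 0 (Suc ` snd p) = {fst q} \<times> insert 0 (Suc ` snd q)"
      by (simp only: inj_image_eq_iff[OF inj_prod_encode])
    then have "fst p = fst q" and eq: "insert 0 (Suc ` snd p) = insert 0 (Suc ` snd q)"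
      unfolding times_eq_iff by auto
    moreover have "Suc ` snd p = Suc ` snd q"
      using eq by (auto simp: set_eq_iff)
    ultimately show "p = q" by (simp add: prod_eq_iff inj_image_eq_iff)
  qed
  then have "inj (\<lambda>x. h ` Collect x)"
    by (intro injI) (simp add: inj_image_eq_iff Collect_inj)
  then show ?thesis by (rule exI[of _ "\<lambda>x. h ` Collect x"])
qed

theorem theorem4p4:
  shows "\<exists>(\<Omega> :: nat set set set set) A.
           algebra \<Omega> A \<and> approximable \<Omega> A \<and>
           \<not> (\<exists>\<mu>. fa_measure A \<mu> \<and> strictly_positive A \<mu> \<and> separable_measure A \<mu>)"
proof -
  obtain g :: "point \<Rightarrow> nat set set set" where g: "inj g" using ex_inj_point ..
  have "\<not> (\<exists>\<mu>. fa_measure ((`) g ` clp) \<mu> \<and> strictly_positive ((`) g ` clp) \<mu> \<and>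
      separable_measure ((`) g ` clp) \<mu>)"
    using preimage_measure[OF g] not_strictly_positive_separable_clp by metis
  then show ?thesis
    using image_algebra[OF g algebra_clp] image_approximable[OF g approximable_clp]
    by (intro exI[of _ "range g"] exI[of _ "(`) g ` clp"] conjI)
qed

end
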